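(* A Banach space $X$ has the Grothendieck property if and only if every weak$^{*}$ null sequence in $X^{*}$ admits a convex block subsequence that is norm null.
   Context: Banach spaces are infinite-dimensional, over the real or complex field. $X$ has the Grothendieck property if every weak$^*$ convergent sequence in $X^*$ converges weakly. A sequence $(y_n)_{n=1}^\infty$ is a convex block subsequence of $(x_n)_{n=1}^\infty$ if there is a strictly increasing sequence of positive integers $(k_n)_{n=1}^\infty$ such that, with $k_0=0$, $y_n\in\operatorname{conv}\{x_i: k_{n-1}+1\leqslant i\leqslant k_n\}$ for every $n\in\mathbb N$. *)

theory Defs
  imports "HOL-Analysis.Analysis"
begin

text \<open>
  Banach spaces over the field \<open>'k\<close>, which is \<open>real\<close> or \<open>complex\<close> in all uses below.
  The class \<open>banach\<close> supplies the norm, completeness and the underlying real structure; \<open>smul\<close> is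
  the scalar multiplication. For \<open>'k = real\<close> the only instance is \<open>scaleR\<close>.
\<close>

locale banach_space_over = vector_space smul
  for smul :: "'k::real_normed_field \<Rightarrow> 'a::banach \<Rightarrow> 'a" +
  assumes smul_of_real: "smul (of_real r) x = r *\<^sub>R x"
    and norm_smul: "norm (smul c x) = norm c * norm x"

lemma banach_space_over_scaleR: "banach_space_over ((*\<^sub>R) :: real \<Rightarrow> 'a::banach \<Rightarrow> 'a)"
  by unfold_locales (auto simp: algebra_simps)

definition infinite_dimensional :: "('k::field \<Rightarrow> 'a::ab_group_add \<Rightarrow> 'a) \<Rightarrow> bool" where
  "infinite_dimensional smul \<longleftrightarrow> \<not> (\<exists>B. finite B \<and> module.span smul B = UNIV)"

text \<open>
  The elements of \<open>'a \<Rightarrow>\<^sub>L 'k\<close> are the bounded real-linear maps; \<open>X\<^sup>*\<close> consists of those that are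
  linear over \<open>'k\<close>. Its norm is the one of the ambient type, that is, the operator norm.
\<close>

definition dual_space ::
  "('k::real_normed_field \<Rightarrow> 'a::real_normed_vector \<Rightarrow> 'a) \<Rightarrow> ('a \<Rightarrow>\<^sub>L 'k) set" where
  "dual_space smul = {f. \<forall>c x. blinfun_apply f (smul c x) = c * blinfun_apply f x}"

definition dual_scale ::
  "'k::real_normed_field \<Rightarrow> ('a::real_normed_vector \<Rightarrow>\<^sub>L 'k) \<Rightarrow> ('a \<Rightarrow>\<^sub>L 'k)" where
  "dual_scale c f = blinfun_mult_right c o\<^sub>L f"

lemma blinfun_apply_dual_scale [simp]:
  "blinfun_apply (dual_scale c f) x = c * blinfun_apply f x"
  by (simp add: dual_scale_def)

text \<open>
  \<open>X\<^sup>*\<^sup>*\<close>: bounded linear functionals on \<open>X\<^sup>*\<close>. Since \<open>X\<^sup>*\<close> is a subset of a type, they are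
  represented by functions whose values outside \<open>X\<^sup>*\<close> are irrelevant.
\<close>

definition bidual_space ::
  "('k::real_normed_field \<Rightarrow> 'a::real_normed_vector \<Rightarrow> 'a) \<Rightarrow> (('a \<Rightarrow>\<^sub>L 'k) \<Rightarrow> 'k) set" where
  "bidual_space smul = {\<phi>.
     (\<forall>f\<in>dual_space smul. \<forall>g\<in>dual_space smul. \<phi> (f + g) = \<phi> f + \<phi> g) \<and>
     (\<forall>c. \<forall>f\<in>dual_space smul. \<phi> (dual_scale c f) = c * \<phi> f) \<and>
     (\<exists>C. \<forall>f\<in>dual_space smul. norm (\<phi> f) \<le> C * norm f)}"

definition weak_star_converges ::
  "('k::real_normed_field \<Rightarrow> 'a::real_normed_vector \<Rightarrow> 'a) \<Rightarrow>
   (nat \<Rightarrow> 'a \<Rightarrow>\<^sub>L 'k) \<Rightarrow> ('a \<Rightarrow>\<^sub>L 'k) \<Rightarrow> bool" where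
  "weak_star_converges smul f l \<longleftrightarrow>
     (\<forall>n. f n \<in> dual_space smul) \<and> l \<in> dual_space smul \<and>
     (\<forall>x. (\<lambda>n. blinfun_apply (f n) x) \<longlonglongrightarrow> blinfun_apply l x)"

definition weakly_converges ::
  "('k::real_normed_field \<Rightarrow> 'a::real_normed_vector \<Rightarrow> 'a) \<Rightarrow>
   (nat \<Rightarrow> 'a \<Rightarrow>\<^sub>L 'k) \<Rightarrow> ('a \<Rightarrow>\<^sub>L 'k) \<Rightarrow> bool" where
  "weakly_converges smul f l \<longleftrightarrow>
     (\<forall>n. f n \<in> dual_space smul) \<and> l \<in> dual_space smul \<and>
     (\<forall>\<phi>\<in>bidual_space smul. (\<lambda>n. \<phi> (f n)) \<longlonglongrightarrow> \<phi> l)"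

text \<open>
  Weak convergence in \<open>X\<^sup>*\<close> implies weak* convergence to the same limit, so requiring the two
  limits to coincide is no restriction.
\<close>

definition grothendieck_property ::
  "('k::real_normed_field \<Rightarrow> 'a::real_normed_vector \<Rightarrow> 'a) \<Rightarrow> bool" where
  "grothendieck_property smul \<longleftrightarrow>
     (\<forall>f l. weak_star_converges smul f l \<longrightarrow> weakly_converges smul f l)"

text \<open>
  Sequences are indexed from 0 instead of 1, so the \<open>n\<close>-th block \<open>k\<^sub>n\<^sub>-\<^sub>1 + 1 \<le> i \<le> k\<^sub>n\<close> becomes
  \<open>k n \<le> i < k (Suc n)\<close>.
\<close>

definition convex_block_subsequence ::
  "(nat \<Rightarrow> 'b::real_vector) \<Rightarrow> (nat \<Rightarrow> 'b) \<Rightarrow> bool" where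
  "convex_block_subsequence y x \<longleftrightarrow>
     (\<exists>k. strict_mono k \<and> k 0 = (0::nat) \<and>
          (\<forall>n. y n \<in> convex hull (x ` {k n..<k (Suc n)})))"

end

theory Submission
  imports Defs
begin

text \<open>
  If weak* convergence implies weak convergence, Mazur's theorem gives norm small convex combinations
  of every tail of a weak* null sequence, and these are strung together to blocks. Conversely, if
  some \<open>\<phi>\<close> in the bidual does not tend to 0 along a weak* null sequence, some real
  coordinate of \<open>\<phi>\<close> or \<open>-\<phi>\<close> is at least \<open>e > 0\<close> on a subsequence, hence on all its convex block
  subsequences, which therefore stay away from 0 in norm.

  The separation behind Mazur's theorem comes from sublinear functionals: those below a given one
  have minimal elements, minimal ones are linear, and lowering a sublinear functional along a convex
  set serves both to show this linearity and to encode the separation.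
\<close>

section \<open>Sublinear functionals and the Hahn-Banach theorem\<close>

definition sublinear :: "('b::real_vector \<Rightarrow> real) \<Rightarrow> bool" where
  "sublinear p \<longleftrightarrow> (\<forall>x y. p (x + y) \<le> p x + p y) \<and> (\<forall>t x. 0 \<le> t \<longrightarrow> p (t *\<^sub>R x) = t * p x)"

lemma sublinear_add: "sublinear p \<Longrightarrow> p (x + y) \<le> p x + p y"
  and sublinear_scaleR: "sublinear p \<Longrightarrow> 0 \<le> t \<Longrightarrow> p (t *\<^sub>R x) = t * p x"
  by (auto simp: sublinear_def)

lemma sublinear_zero: "sublinear p \<Longrightarrow> p 0 = 0"
  using sublinear_scaleR[of p 0 0] by simp

lemma sublinear_lower: "sublinear p \<Longrightarrow> - p (- x) \<le> p x"
  using sublinear_add[of p x "- x"] sublinear_zero[of p] by simp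

lemma sublinear_norm: "sublinear norm"
  by (auto simp: sublinear_def norm_triangle_ineq)

text \<open>Applying \<open>scale\<close> with factor \<open>1 / t\<close> to the vector
  \<open>t *\<^sub>R x\<close> gives the reverse inequality, so one half of homogeneity
  suffices.\<close>

lemma sublinearI:
  fixes p :: "'b::real_vector \<Rightarrow> real"
  assumes add: "\<And>x y. p (x + y) \<le> p x + p y" and zero: "p 0 = 0"
    and scale: "\<And>t x. 0 < t \<Longrightarrow> t * p x \<le> p (t *\<^sub>R x)"
  shows "sublinear p"
proof -
  have "p (t *\<^sub>R x) = t * p x" if "0 \<le> t" for t x
  proof (cases "t = 0")
    case False
    with that have t: "0 < t" by simp
    have "(1 / t) * p (t *\<^sub>R x) \<le> p ((1 / t) *\<^sub>R (t *\<^sub>R x))"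
      using t by (intro scale) simp
    with t have "p (t *\<^sub>R x) \<le> t * p x" by (simp add: field_simps)
    with scale[OF t, of x] show ?thesis by simp
  qed (simp add: zero)
  with add show ?thesis by (simp add: sublinear_def)
qed

text \<open>The witness is the infimum of \<open>p (x + t *\<^sub>R c) - t * d\<close> over
  \<open>t \<ge> 0\<close> and \<open>c \<in> C\<close>. It is the largest candidate: a sublinear
  \<open>r\<close> below \<open>p\<close> with \<open>r (- c) \<le> - d\<close> satisfies
  \<open>r x \<le> r (x + t *\<^sub>R c) + t * r (- c)\<close>. The bound \<open>d \<le> p c\<close>
  keeps the infimum finite.\<close>

lemma sublinear_lowering:
  fixes p :: "'b::real_vector \<Rightarrow> real"
  assumes p: "sublinear p" and C: "convex C" "C \<noteq> {}" and d: "\<And>c. c \<in> C \<Longrightarrow> d \<le> p c"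
  obtains q where "sublinear q" "\<And>x. q x \<le> p x" "\<And>c. c \<in> C \<Longrightarrow> q (- c) \<le> - d"
proof -
  define S where "S x = {p (x + t *\<^sub>R c) - t * d |t c. 0 \<le> t \<and> c \<in> C}" for x
  define q where "q x = Inf (S x)" for x
  have lb: "- p (- x) \<le> s" if "s \<in> S x" for x s
  proof -
    from that obtain t c where s: "s = p (x + t *\<^sub>R c) - t * d" and t: "0 \<le> t" and c: "c \<in> C"
      by (auto simp: S_def)
    have "t * d \<le> p (t *\<^sub>R c)"
      using d[OF c] t by (simp add: sublinear_scaleR[OF p] mult_left_mono)
    also have "\<dots> \<le> p (x + t *\<^sub>R c) + p (- x)"
      using sublinear_add[OF p, of "x + t *\<^sub>R c" "- x"] by simp
    finally show ?thesis by (simp add: s)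
  qed
  have bdd: "bdd_below (S x)" for x
    using lb by (meson bdd_belowI)
  have ne: "S x \<noteq> {}" for x
    using C(2) by (auto simp: S_def)
  have q_le: "q x \<le> p (x + t *\<^sub>R c) - t * d" if "0 \<le> t" "c \<in> C" for x t c
    unfolding q_def by (rule cInf_lower[OF _ bdd]) (use that in \<open>auto simp: S_def\<close>)
  have le_q: "r \<le> q x" if "\<And>t c. 0 \<le> t \<Longrightarrow> c \<in> C \<Longrightarrow> r \<le> p (x + t *\<^sub>R c) - t * d" for r x
    unfolding q_def by (rule cInf_greatest[OF ne]) (use that in \<open>auto simp: S_def\<close>)
  have qp: "q x \<le> p x" for x
    using C(2) q_le[of 0 _ x] by auto
  have "sublinear q"
  proof (rule sublinearI)
    fix x y
    have *: "q (x + y) \<le> (p (x + s *\<^sub>R b) - s * d) + (p (y + t *\<^sub>R c) - t * d)"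
      if st: "0 \<le> s" "0 \<le> t" and bc: "b \<in> C" "c \<in> C" for s t b c
    proof -
      \<comment> \<open>Convexity merges the two shifts into a single one along \<open>C\<close>
        with parameter \<open>s + t\<close>; if both parameters vanish, any point of
        \<open>C\<close> will do.\<close>
      obtain e where e: "e \<in> C" "(s + t) *\<^sub>R e = s *\<^sub>R b + t *\<^sub>R c"
      proof (cases "s + t = 0")
        case True
        with st have "s = 0" "t = 0" by auto
        with bc that show ?thesis by auto
      next
        case False
        with st have "0 < s + t" by simp
        then have "(s / (s + t)) *\<^sub>R b + (t / (s + t)) *\<^sub>R c \<in> C"
          using st bc by (intro convexD[OF C(1)]) (auto simp flip: add_divide_distrib)
        with False that show ?thesis by (simp add: scaleR_right_distrib)
      qed
      have "q (x + y) \<le> p ((x + y) + (s + t) *\<^sub>R e) - (s + t) * d"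
        using st e by (intro q_le) auto
      also have "(x + y) + (s + t) *\<^sub>R e = (x + s *\<^sub>R b) + (y + t *\<^sub>R c)"
        using e by simp
      also have "p \<dots> \<le> p (x + s *\<^sub>R b) + p (y + t *\<^sub>R c)"
        by (rule sublinear_add[OF p])
      finally show ?thesis by (simp add: algebra_simps)
    qed
    \<comment> \<open>The two infima are taken one after the other: first over \<open>(s, b)\<close>
      with \<open>(t, c)\<close> fixed, then over \<open>(t, c)\<close>.\<close>
    have "q (x + y) - (p (y + t *\<^sub>R c) - t * d) \<le> q x" if "0 \<le> t" "c \<in> C" for t c
    proof (rule le_q)
      fix s :: real and b assume "0 \<le> s" "b \<in> C"
      then show "q (x + y) - (p (y + t *\<^sub>R c) - t * d) \<le> p (x + s *\<^sub>R b) - s * d"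
        using *[of s t b c] that by linarith
    qed
    then have "q (x + y) - q x \<le> q y"
      by (intro le_q) (simp add: diff_le_eq add.commute)
    then show "q (x + y) \<le> q x + q y" by simp
  next
    have "0 \<le> q 0"
      unfolding q_def by (rule cInf_greatest[OF ne]) (use lb[of _ 0] sublinear_zero[OF p] in auto)
    with qp[of 0] show "q 0 = 0" by (simp add: sublinear_zero[OF p])
  next
    fix s x assume s: "(0::real) < s"
    show "s * q x \<le> q (s *\<^sub>R x)"
    proof (rule le_q)
      fix t :: real and c assume "0 \<le> t" "c \<in> C"
      \<comment> \<open>The pair \<open>(t, c)\<close> for \<open>s *\<^sub>R x\<close> corresponds
        to the pair \<open>(t / s, c)\<close> for \<open>x\<close>.\<close>
      then have "s * q x \<le> s * (p (x + (t / s) *\<^sub>R c) - (t / s) * d)"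
        using s by (intro mult_left_mono q_le) auto
      also have "\<dots> = p (s *\<^sub>R (x + (t / s) *\<^sub>R c)) - t * d"
        using s sublinear_scaleR[OF p, of s] by (simp add: right_diff_distrib)
      also have "s *\<^sub>R (x + (t / s) *\<^sub>R c) = s *\<^sub>R x + t *\<^sub>R c"
        using s by (simp add: scaleR_right_distrib)
      finally show "s * q x \<le> p (s *\<^sub>R x + t *\<^sub>R c) - t * d" .
    qed
  qed
  moreover have "q (- c) \<le> - d" if "c \<in> C" for c
    using q_le[of 1 c "- c"] that by (simp add: sublinear_zero[OF p])
  ultimately show ?thesis using qp that by blast
qed

text \<open>Subadditivity is where the chain matters: \<open>q\<close> and \<open>r\<close>, chosen
  separately for \<open>x\<close> and \<open>y\<close>, can both be replaced by the smaller of the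
  two.\<close>

lemma sublinear_INF:
  fixes K :: "('b::real_vector \<Rightarrow> real) set"
  assumes K: "K \<noteq> {}" "\<And>q. q \<in> K \<Longrightarrow> sublinear q" "\<And>q. q \<in> K \<Longrightarrow> q \<le> p"
    and chain: "\<And>q r. q \<in> K \<Longrightarrow> r \<in> K \<Longrightarrow> q \<le> r \<or> r \<le> q"
  shows "sublinear (\<lambda>x. INF q\<in>K. q x)" and "\<And>q. q \<in> K \<Longrightarrow> (\<lambda>x. INF q\<in>K. q x) \<le> q"
proof -
  \<comment> \<open>A bound common to all members:
    \<open>- p (- x) \<le> - q (- x) \<le> q x\<close>.\<close>
  have "bdd_below ((\<lambda>q. q x) ` K)" for x
  proof (rule bdd_belowI2)
    fix q assume "q \<in> K"
    then show "- p (- x) \<le> q x"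
      using sublinear_lower[of q x] K(2,3) by (force simp: le_fun_def dest: spec[of _ "- x"])
  qed
  then have low: "(INF q\<in>K. q x) \<le> q x" if "q \<in> K" for q x
    using that by (intro cINF_lower) auto
  then show "(\<lambda>x. INF q\<in>K. q x) \<le> q" if "q \<in> K" for q
    using that by (simp add: le_fun_def)
  have great: "r \<le> (INF q\<in>K. q x)" if "\<And>q. q \<in> K \<Longrightarrow> r \<le> q x" for r x
    using K(1) that by (intro cINF_greatest) auto
  show "sublinear (\<lambda>x. INF q\<in>K. q x)"
  proof (rule sublinearI)
    fix x y
    have *: "(INF q\<in>K. q (x + y)) \<le> q x + r y" if qr: "q \<in> K" "r \<in> K" for q r
    proof -
      obtain s where s: "s \<in> K" "s \<le> q" "s \<le> r"
        using chain[OF qr] qr by blast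
      have "(INF q\<in>K. q (x + y)) \<le> s x + s y"
        using low[OF s(1)] sublinear_add[OF K(2)[OF s(1)]] order_trans by blast
      also have "\<dots> \<le> q x + r y"
        by (rule add_mono[OF le_funD[OF s(2)] le_funD[OF s(3)]])
      finally show ?thesis .
    qed
    have "(INF q\<in>K. q (x + y)) - r y \<le> (INF q\<in>K. q x)" if "r \<in> K" for r
      using *[OF _ that] by (intro great) (simp add: diff_le_eq)
    then have "(INF q\<in>K. q (x + y)) - (INF q\<in>K. q x) \<le> (INF q\<in>K. q y)"
      by (intro great) (simp add: diff_le_eq add.commute)
    then show "(INF q\<in>K. q (x + y)) \<le> (INF q\<in>K. q x) + (INF q\<in>K. q y)" by simp
  next
    have "(\<lambda>q. q 0) ` K = {0}"
      using K(1) sublinear_zero[OF K(2)] by force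
    then show "(INF q\<in>K. q 0) = 0" by simp
  next
    fix t x assume t: "(0::real) < t"
    show "t * (INF q\<in>K. q x) \<le> (INF q\<in>K. q (t *\<^sub>R x))"
      using t by (intro great) (simp add: sublinear_scaleR[OF K(2)] low)
  qed
qed

lemma sublinear_minimal_below:
  fixes p :: "'b::real_vector \<Rightarrow> real"
  assumes p: "sublinear p"
  obtains m where "sublinear m" "m \<le> p" "\<And>q. sublinear q \<Longrightarrow> q \<le> m \<Longrightarrow> q = m"
proof -
  define A where "A = {q. sublinear q \<and> q \<le> p}"
  have "\<exists>m\<in>A. \<forall>q\<in>A. q \<le> m \<longrightarrow> q = m"
  \<comment> \<open>Zorn's lemma yields maximal elements, so the order is reversed and the upper
    bound of a chain is its pointwise infimum.\<close>
  proof (rule predicate_Zorn[where P = "\<lambda>q r. r \<le> q"])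
    show "partial_order_on A (relation_of (\<lambda>q r. r \<le> q) A)"
      by (rule partial_order_on_relation_ofI) auto
  next
    fix K assume K: "K \<in> Chains (relation_of (\<lambda>q r. r \<le> q) A)"
    then have KA: "K \<subseteq> A" and chain: "\<And>q r. q \<in> K \<Longrightarrow> r \<in> K \<Longrightarrow> q \<le> r \<or> r \<le> q"
      by (auto simp: Chains_def relation_of_def)
    show "\<exists>u\<in>A. \<forall>q\<in>K. u \<le> q"
    proof (cases "K = {}")
      case True
      with p show ?thesis by (auto simp: A_def)
    next
      case False
      note inf = sublinear_INF[of K p, OF False]
      have "sublinear (\<lambda>x. INF q\<in>K. q x)" "\<And>q. q \<in> K \<Longrightarrow> (\<lambda>x. INF q\<in>K. q x) \<le> q"
        using inf KA chain by (auto simp: A_def subset_iff)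
      \<comment> \<open>Some member of the chain is needed to place the infimum below
        \<open>p\<close>.\<close>
      moreover from False KA obtain r where "r \<in> K" "r \<le> p" by (auto simp: A_def)
      ultimately show ?thesis unfolding A_def by (blast intro: order_trans)
    qed
  qed
  then show ?thesis using that by (auto simp: A_def intro: order_trans)
qed

text \<open>This is the Hahn-Banach theorem. Lowering a minimal \<open>m\<close> along the single
  point \<open>y\<close> with \<open>d = m y\<close> cannot change it, which makes \<open>m\<close>
  odd; an odd sublinear functional is linear.\<close>

lemma linear_below_sublinear:
  fixes p :: "'b::real_vector \<Rightarrow> real"
  assumes "sublinear p"
  obtains h where "linear h" "\<And>x. h x \<le> p x"
proof -
  obtain m where m: "sublinear m" "m \<le> p" and min: "\<And>q. sublinear q \<Longrightarrow> q \<le> m \<Longrightarrow> q = m"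
    using sublinear_minimal_below[OF assms] by metis
  have neg: "m (- y) = - m y" for y
  proof -
    obtain q where "sublinear q" "\<And>x. q x \<le> m x" "q (- y) \<le> - m y"
      using sublinear_lowering[OF m(1), of "{y}" "m y"] by auto
    then have "m (- y) \<le> - m y"
      using min[of q] by (simp add: le_fun_def)
    with sublinear_lower[OF m(1), of y] show ?thesis by linarith
  qed
  have "linear m"
  proof (rule linearI)
    fix x y
    \<comment> \<open>Subadditivity at the negated vectors becomes superadditivity by
      oddness.\<close>
    have "m (- x + - y) \<le> m (- x) + m (- y)"
      by (rule sublinear_add[OF m(1)])
    then have "m x + m y \<le> m (x + y)"
      using neg[of "x + y"] by (simp add: neg)
    with sublinear_add[OF m(1)] show "m (x + y) = m x + m y" by (simp add: antisym)
  next
    fix t :: real and x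
    show "m (t *\<^sub>R x) = t *\<^sub>R m x"
      using sublinear_scaleR[OF m(1), of t x] sublinear_scaleR[OF m(1), of "- t" x] neg[of "t *\<^sub>R x"]
      by (cases "0 \<le> t") auto
  qed
  with m(2) that show ?thesis by (auto simp: le_fun_def)
qed

section \<open>Separation and Mazur's theorem in block form\<close>

text \<open>Any linear functional below the norm lowered along \<open>C\<close> works:
  \<open>h (- c) \<le> - d\<close> turns into \<open>d \<le> h c\<close>, and being below the norm
  at both \<open>x\<close> and \<open>- x\<close> bounds the absolute value.\<close>

lemma convex_norm_separation:
  fixes C :: "'b::real_normed_vector set"
  assumes "convex C" "C \<noteq> {}" "\<And>c. c \<in> C \<Longrightarrow> d \<le> norm c"
  obtains h where "linear h" "\<And>x. \<bar>h x\<bar> \<le> norm x" "\<And>c. c \<in> C \<Longrightarrow> d \<le> h c"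
proof -
  obtain q where q: "sublinear q" "\<And>x. q x \<le> norm x" "\<And>c. c \<in> C \<Longrightarrow> q (- c) \<le> - d"
    using sublinear_lowering[OF sublinear_norm assms] by metis
  obtain h where h: "linear h" "\<And>x. h x \<le> q x"
    using linear_below_sublinear[OF q(1)] by metis
  note neg = linear_neg[OF h(1)]
  have "\<bar>h x\<bar> \<le> norm x" for x
    using h(2)[of x] h(2)[of "- x"] q(2)[of x] q(2)[of "- x"] by (simp add: neg)
  moreover have "d \<le> h c" if "c \<in> C" for c
    using h(2)[of "- c"] q(3)[OF that] by (simp add: neg)
  ultimately show ?thesis using h(1) that by blast
qed

text \<open>Blocks are chosen greedily: block \<open>n\<close> starts where the previous one ends
  and carries a combination of norm below \<open>1 / (n + 1)\<close>.\<close>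

lemma convex_blocks_of_small_tails:
  fixes f :: "nat \<Rightarrow> 'b::real_normed_vector"
  assumes tails: "\<And>N e. 0 < e \<Longrightarrow> \<exists>M>N. \<exists>c\<in>convex hull (f ` {N..<M}). norm c < e"
  obtains g where "convex_block_subsequence g f" "g \<longlonglongrightarrow> 0"
proof -
  have "\<exists>M c. N < M \<and> c \<in> convex hull (f ` {N..<M}) \<and> norm c < inverse (real (Suc n))" for N n
    using tails[of "inverse (real (Suc n))" N] by auto
  then obtain M c where Mc: "\<And>N n. N < M N n" "\<And>N n. c N n \<in> convex hull (f ` {N..<M N n})"
    "\<And>N n. norm (c N n) < inverse (real (Suc n))"
    by metis
  \<comment> \<open>\<open>M N n\<close> is the end of block \<open>n\<close> when that block starts
    at \<open>N\<close>, so the recursion depends on both the current end and the index.\<close>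
  define k where "k = rec_nat 0 (\<lambda>n N. M N n)"
  have k: "k 0 = 0" "\<And>n. k (Suc n) = M (k n) n"
    by (simp_all add: k_def)
  have "convex_block_subsequence (\<lambda>n. c (k n) n) f"
    unfolding convex_block_subsequence_def
    using Mc(1,2) k by (intro exI[of _ k]) (auto simp: strict_mono_Suc_iff)
  moreover have "(\<lambda>n. c (k n) n) \<longlonglongrightarrow> 0"
    by (rule Lim_null_comparison[OF _ LIMSEQ_inverse_real_of_nat])
      (use Mc(3) in \<open>auto intro!: always_eventually less_imp_le\<close>)
  ultimately show ?thesis by (rule that)
qed

text \<open>If all convex combinations of a tail had norm at least \<open>e\<close>, a separating
  \<open>h\<close> would satisfy \<open>h (f n) \<ge> e\<close> along that tail, against
  \<open>null\<close>.\<close>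

lemma mazur_convex_blocks:
  fixes f :: "nat \<Rightarrow> 'b::real_normed_vector"
  assumes null: "\<And>h. linear h \<Longrightarrow> (\<And>x. \<bar>h x\<bar> \<le> norm x) \<Longrightarrow> (\<lambda>n. h (f n)) \<longlonglongrightarrow> (0::real)"
  obtains g where "convex_block_subsequence g f" "g \<longlonglongrightarrow> 0"
proof (rule convex_blocks_of_small_tails[OF _ that])
  fix N and e :: real assume e: "0 < e"
  \<comment> \<open>The hull of the tail, written as an increasing union so that each point brings
    along an end \<open>M > N\<close> for its block.\<close>
  define C where "C = (\<Union>M\<in>{N<..}. convex hull (f ` {N..<M}))"
  have "convex C"
  proof (rule convexI)
    fix x y and u v :: real
    assume "x \<in> C" "y \<in> C" and uv: "0 \<le> u" "0 \<le> v" "u + v = 1"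
    then obtain K L where K: "N < K" "x \<in> convex hull (f ` {N..<K})"
      and L: "N < L" "y \<in> convex hull (f ` {N..<L})"
      by (auto simp: C_def)
    have "x \<in> convex hull (f ` {N..<max K L})"
      by (rule subsetD[OF hull_mono[OF image_mono] K(2)]) simp
    moreover have "y \<in> convex hull (f ` {N..<max K L})"
      by (rule subsetD[OF hull_mono[OF image_mono] L(2)]) simp
    ultimately have "u *\<^sub>R x + v *\<^sub>R y \<in> convex hull (f ` {N..<max K L})"
      using uv by (rule convexD[OF convex_convex_hull])
    then show "u *\<^sub>R x + v *\<^sub>R y \<in> C"
      unfolding C_def by (rule UN_I[rotated]) (use K(1) in simp)
  qed
  have tail: "f n \<in> C" if "N \<le> n" for n
    unfolding C_def by (rule UN_I[of "Suc n"]) (use that in \<open>auto intro!: hull_inc\<close>)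
  have "\<exists>c\<in>C. norm c < e"
  proof (rule ccontr)
    assume "\<not> (\<exists>c\<in>C. norm c < e)"
    then have "e \<le> norm c" if "c \<in> C" for c
      using that by force
    moreover have "C \<noteq> {}"
      using tail by blast
    ultimately obtain h
      where h: "linear h" "\<And>x. \<bar>h x\<bar> \<le> norm x" "\<And>c. c \<in> C \<Longrightarrow> e \<le> h c"
      using convex_norm_separation[OF \<open>convex C\<close>] by metis
    have "\<forall>\<^sub>F n in sequentially. h (f n) < e"
      using order_tendstoD(2)[OF null[OF h(1,2)] e] .
    then obtain L where "\<forall>n\<ge>L. h (f n) < e"
      by (auto simp: eventually_sequentially)
    then have "h (f (max N L)) < e" by simp
    with h(3)[OF tail[of "max N L"]] show False by simp
  qed
  then show "\<exists>M>N. \<exists>c\<in>convex hull (f ` {N..<M}). norm c < e"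
    by (auto simp: C_def)
qed

section \<open>From the Grothendieck property to null blocks\<close>

lemma subspace_dual_space: "subspace (dual_space smul)"
  by (auto simp: subspace_def dual_space_def algebra_simps blinfun.add_left blinfun.scaleR_left)

lemma bidual_scaleR:
  assumes "\<phi> \<in> bidual_space smul" "f \<in> dual_space smul"
  shows "\<phi> (r *\<^sub>R f) = r *\<^sub>R \<phi> f"
proof -
  have "r *\<^sub>R f = dual_scale (of_real r) f"
    by (rule blinfun_eqI) (simp add: blinfun.scaleR_left scaleR_conv_of_real)
  with assms show ?thesis by (simp add: bidual_space_def scaleR_conv_of_real)
qed

lemma norm_dual_scale_le: "norm (dual_scale c f) \<le> norm c * norm f"
proof (rule norm_blinfun_bound)
  fix x
  show "norm (dual_scale c f x) \<le> norm c * norm f * norm x"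
    using mult_left_mono[OF norm_blinfun[of f x], of "norm c"] by (simp add: norm_mult mult.assoc)
qed simp

text \<open>The assumption on \<open>h\<close> says that \<open>X\<^sup>*\<^sup>*\<close> sees every bounded real functional on \<open>X\<^sup>*\<close>.\<close>

lemma grothendieck_imp_null_blocks:
  assumes "grothendieck_property smul" and f: "weak_star_converges smul f 0"
    and bidual: "\<And>h. linear h \<Longrightarrow> (\<And>x. \<bar>h x\<bar> \<le> norm x) \<Longrightarrow>
      \<exists>\<phi>\<in>bidual_space smul. \<forall>x\<in>dual_space smul. \<bar>h x\<bar> \<le> norm (\<phi> x)"
  shows "\<exists>g. convex_block_subsequence g f \<and> g \<longlonglongrightarrow> 0"
proof -
  have weak: "weakly_converges smul f 0"
    using assms(1) f by (simp add: grothendieck_property_def)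
  have "(\<lambda>n. h (f n)) \<longlonglongrightarrow> 0" if h: "linear h" "\<And>x. \<bar>h x\<bar> \<le> norm x" for h :: "_ \<Rightarrow> real"
  proof -
    obtain \<phi> where \<phi>: "\<phi> \<in> bidual_space smul" "\<forall>x\<in>dual_space smul. \<bar>h x\<bar> \<le> norm (\<phi> x)"
      using bidual[OF h] by blast
    have "0 \<in> dual_space smul"
      by (rule subspace_0[OF subspace_dual_space])
    \<comment> \<open>The weak limit is \<open>\<phi> 0\<close>, and homogeneity identifies it as
      0.\<close>
    from bidual_scaleR[OF \<phi>(1) this, of 0] have "\<phi> 0 = 0" by simp
    with weak \<phi>(1) have "(\<lambda>n. \<phi> (f n)) \<longlonglongrightarrow> 0"
      by (auto simp: weakly_converges_def dest: bspec)
    then have "(\<lambda>n. norm (\<phi> (f n))) \<longlonglongrightarrow> 0"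
      by (rule tendsto_norm_zero)
    then show ?thesis
      by (rule Lim_null_comparison[rotated])
        (use weak \<phi>(2) in \<open>auto simp: weakly_converges_def\<close>)
  qed
  then show ?thesis using mazur_convex_blocks[of f] by metis
qed

section \<open>From null blocks to the Grothendieck property\<close>

text \<open>In finite dimension some coordinate fails to tend to 0. It is large in absolute value
  infinitely often, hence infinitely often with one fixed sign, and that sign is absorbed into
  \<open>b\<close>.\<close>

lemma non_null_coordinate_subsequence:
  fixes u :: "nat \<Rightarrow> 'k::euclidean_space"
  assumes "\<not> u \<longlonglongrightarrow> 0"
  obtains b e r where "0 < e" "strict_mono (r :: nat \<Rightarrow> nat)" "\<And>n. e \<le> u (r n) \<bullet> b"
proof -
  obtain b where "\<not> (\<lambda>n. u n \<bullet> b) \<longlonglongrightarrow> 0"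
    using assms tendsto_componentwise_iff[of u 0 sequentially] by auto
  then obtain e where e: "0 < e" "\<And>N. \<exists>n\<ge>N. e \<le> \<bar>u n \<bullet> b\<bar>"
    by (auto simp: LIMSEQ_iff not_less)
  then have "infinite {n. e \<le> \<bar>u n \<bullet> b\<bar>}"
    by (auto simp: infinite_nat_iff_unbounded_le)
  moreover have "{n. e \<le> \<bar>u n \<bullet> b\<bar>} = {n. e \<le> u n \<bullet> b} \<union> {n. e \<le> u n \<bullet> (- b)}"
    by (auto simp: abs_if)
  ultimately obtain b' where "infinite {n. e \<le> u n \<bullet> b'}"
    by (metis finite_Un)
  with e(1) that[of e "enumerate {n. e \<le> u n \<bullet> b'}" b'] show ?thesis
    using enumerate_in_set[of "{n. e \<le> u n \<bullet> b'}"] by (auto simp: strict_mono_enumerate)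
qed

text \<open>The sort \<open>euclidean_space\<close> treats both scalar fields at once: real
  coordinates of scalars are inner products with \<open>b\<close>.\<close>

lemma grothendieck_if_null_blocks:
  fixes smul :: "'k::{real_normed_field,euclidean_space} \<Rightarrow> 'a::banach \<Rightarrow> 'a"
  assumes blocks: "\<And>f. weak_star_converges smul f 0 \<Longrightarrow>
      \<exists>g. convex_block_subsequence g f \<and> g \<longlonglongrightarrow> 0"
  shows "grothendieck_property smul"
proof -
  note sub = subspace_dual_space
  have "weakly_converges smul f l" if fl: "weak_star_converges smul f l" for f l
  proof -
    from fl have f: "\<And>n. f n \<in> dual_space smul" and l: "l \<in> dual_space smul"
      and lim: "\<And>x. (\<lambda>n. f n x) \<longlonglongrightarrow> l x"
      by (auto simp: weak_star_converges_def)
    have "(\<lambda>n. \<phi> (f n)) \<longlonglongrightarrow> \<phi> l" if \<phi>: "\<phi> \<in> bidual_space smul" for \<phi>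
    proof (rule ccontr)
      from \<phi> obtain C where add: "\<And>x y. x \<in> dual_space smul \<Longrightarrow> y \<in> dual_space smul \<Longrightarrow> \<phi> (x + y) = \<phi> x + \<phi> y"
        and C: "\<And>x. x \<in> dual_space smul \<Longrightarrow> norm (\<phi> x) \<le> C * norm x"
        unfolding bidual_space_def by blast
      \<comment> \<open>Translation by \<open>l\<close> reduces to weak* null sequences, the only
        ones that \<open>blocks\<close> speaks about.\<close>
      have "\<phi> (f n - l) = \<phi> (f n) - \<phi> l" for n
        using add[OF subspace_diff[OF sub f[of n] l] l] by simp
      moreover assume "\<not> (\<lambda>n. \<phi> (f n)) \<longlonglongrightarrow> \<phi> l"
      ultimately have "\<not> (\<lambda>n. \<phi> (f n - l)) \<longlonglongrightarrow> 0"
        by (simp add: LIM_zero_iff)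
      then obtain b e and r :: "nat \<Rightarrow> nat" where e: "0 < e" and r: "strict_mono r"
        and low: "\<And>n. e \<le> \<phi> (f (r n) - l) \<bullet> b"
        by (rule non_null_coordinate_subsequence) blast
      let ?f = "\<lambda>n. f (r n) - l"
      have "weak_star_converges smul ?f 0"
        unfolding weak_star_converges_def
      proof (intro conjI allI)
        show "?f n \<in> dual_space smul" for n
          by (rule subspace_diff[OF sub f l])
        show "(\<lambda>n. ?f n x) \<longlonglongrightarrow> blinfun_apply 0 x" for x
          using LIM_zero[OF LIMSEQ_subseq_LIMSEQ[OF lim r]] by (simp add: blinfun.diff_left o_def)
      qed (rule subspace_0[OF sub])
      then obtain g where g: "convex_block_subsequence g ?f" "g \<longlonglongrightarrow> 0"
        using blocks by blast
      \<comment> \<open>A real half-space of the dual: being convex and containing the whole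
        subsequence, it contains every convex block.\<close>
      define H where "H = {x \<in> dual_space smul. e \<le> \<phi> x \<bullet> b}"
      have "convex H"
      proof (rule convexI)
        fix x y and s t :: real
        assume "x \<in> H" "y \<in> H" and st: "0 \<le> s" "0 \<le> t" "s + t = 1"
        then have x: "x \<in> dual_space smul" "e \<le> \<phi> x \<bullet> b" and y: "y \<in> dual_space smul" "e \<le> \<phi> y \<bullet> b"
          by (auto simp: H_def)
        have "e = s * e + t * e"
          using st by (simp flip: distrib_right)
        also have "\<dots> \<le> s * (\<phi> x \<bullet> b) + t * (\<phi> y \<bullet> b)"
          using x y st by (intro add_mono mult_left_mono)
        also have "\<dots> = \<phi> (s *\<^sub>R x + t *\<^sub>R y) \<bullet> b"
          using x(1) y(1)
          by (simp add: add bidual_scaleR[OF \<phi>] subspace_scale[OF sub] inner_add_left)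
        finally show "s *\<^sub>R x + t *\<^sub>R y \<in> H"
          using x(1) y(1) by (simp add: H_def subspace_add[OF sub] subspace_scale[OF sub])
      qed
      moreover have "?f n \<in> H" for n
        using f l low by (simp add: H_def subspace_diff[OF sub])
      ultimately have "convex hull (?f ` I) \<subseteq> H" for I
        by (intro hull_minimal) auto
      with g(1) have gH: "g n \<in> H" for n
        unfolding convex_block_subsequence_def by blast
      \<comment> \<open>Boundedness of \<open>\<phi>\<close> turns the gap in the
        \<open>b\<close>-coordinate into one in norm, which
        \<open>g \<longlonglongrightarrow> 0\<close> contradicts.\<close>
      have "e \<le> C * norm (g n) * norm b" for n
      proof -
        have "e \<le> norm (\<phi> (g n)) * norm b"
          using gH[of n] norm_cauchy_schwarz[of "\<phi> (g n)" b] by (simp add: H_def)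
        also have "\<dots> \<le> C * norm (g n) * norm b"
          using gH[of n] by (intro mult_right_mono C) (auto simp: H_def)
        finally show ?thesis .
      qed
      moreover have "(\<lambda>n. C * norm (g n) * norm b) \<longlonglongrightarrow> 0"
        by (intro tendsto_mult_left_zero tendsto_mult_right_zero tendsto_norm_zero g(2))
      ultimately have "e \<le> 0"
        by (intro LIMSEQ_le_const) auto
      with e show False by simp
    qed
    with f l show ?thesis by (simp add: weakly_converges_def)
  qed
  then show ?thesis by (simp add: grothendieck_property_def)
qed

section \<open>Bidual elements from real functionals, for both scalar fields\<close>

lemma real_functional_in_bidual:
  fixes h :: "('a::banach \<Rightarrow>\<^sub>L real) \<Rightarrow> real"
  assumes "linear h" "\<And>x. \<bar>h x\<bar> \<le> norm x"
  shows "h \<in> bidual_space (*\<^sub>R)"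
proof -
  have "dual_scale c x = c *\<^sub>R x" for c and x :: "'a \<Rightarrow>\<^sub>L real"
    by (rule blinfun_eqI) (simp add: blinfun.scaleR_left)
  then show ?thesis
    using assms by (auto simp: bidual_space_def linear_add linear_scale intro!: exI[of _ 1])
qed

text \<open>The usual complexification \<open>h x - \<i> h (\<i> x)\<close> is complex linear and
  has real part \<open>h\<close>, so its modulus dominates \<open>h\<close>.\<close>

lemma complex_bidual_dominates_real_functional:
  fixes h :: "('a::banach \<Rightarrow>\<^sub>L complex) \<Rightarrow> real"
  assumes h: "linear h" "\<And>x. \<bar>h x\<bar> \<le> norm x"
  shows "\<exists>\<phi>\<in>bidual_space smul. \<forall>x\<in>dual_space smul. \<bar>h x\<bar> \<le> norm (\<phi> x)"
proof (intro bexI ballI)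
  let ?\<phi> = "\<lambda>x. Complex (h x) (- h (dual_scale \<i> x))"
  show "\<bar>h x\<bar> \<le> norm (?\<phi> x)" for x
    using abs_Re_le_cmod[of "?\<phi> x"] by simp
  have add: "dual_scale c (x + y) = dual_scale c x + dual_scale c y" for c and x y :: "'a \<Rightarrow>\<^sub>L complex"
    by (rule blinfun_eqI) (simp add: blinfun.add_left algebra_simps)
  have scale: "dual_scale c x = Re c *\<^sub>R x + Im c *\<^sub>R dual_scale \<i> x"
    "dual_scale \<i> (dual_scale c x) = Re c *\<^sub>R dual_scale \<i> x - Im c *\<^sub>R x"
    for c and x :: "'a \<Rightarrow>\<^sub>L complex"
    by (rule blinfun_eqI; simp add: blinfun.add_left blinfun.diff_left blinfun.scaleR_left complex_eq_iff)+
  \<comment> \<open>Real and imaginary part contribute \<open>norm x\<close> each; this crude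
    constant is enough for boundedness.\<close>
  have "norm (?\<phi> x) \<le> 2 * norm x" for x
  proof -
    have "\<bar>h (dual_scale \<i> x)\<bar> \<le> norm x"
      using h(2)[of "dual_scale \<i> x"] norm_dual_scale_le[of \<i> x] by simp
    with h(2)[of x] cmod_le[of "?\<phi> x"] show ?thesis by simp
  qed
  moreover have "?\<phi> (dual_scale c x) = c * ?\<phi> x" for c x
    \<comment> \<open>The nested scaling is expanded first. Fixing \<open>c\<close> keeps
      \<open>scale(1)\<close> from rewriting the \<open>dual_scale \<i>\<close> on its own
      right-hand side.\<close>
    unfolding scale(2)[of c] unfolding scale(1)[of c]
    by (simp add: complex_eq_iff linear_add[OF h(1)] linear_diff[OF h(1)] linear_scale[OF h(1)])
  moreover have "?\<phi> (x + y) = ?\<phi> x + ?\<phi> y" for x y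
    by (simp add: complex_eq_iff add linear_add[OF h(1)])
  ultimately show "?\<phi> \<in> bidual_space smul"
    unfolding bidual_space_def by blast
qed

theorem proposition4p2:
  shows
    "(infinite_dimensional ((*\<^sub>R) :: real \<Rightarrow> 'a::banach \<Rightarrow> 'a) \<longrightarrow>
        (grothendieck_property ((*\<^sub>R) :: real \<Rightarrow> 'a \<Rightarrow> 'a) \<longleftrightarrow>
          (\<forall>f. weak_star_converges ((*\<^sub>R) :: real \<Rightarrow> 'a \<Rightarrow> 'a) f 0 \<longrightarrow>
             (\<exists>g. convex_block_subsequence g f \<and> g \<longlonglongrightarrow> 0)))) \<and>
     (\<forall>smul :: complex \<Rightarrow> 'a \<Rightarrow> 'a.
        banach_space_over smul \<and> infinite_dimensional smul \<longrightarrow>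
        (grothendieck_property smul \<longleftrightarrow>
          (\<forall>f. weak_star_converges smul f 0 \<longrightarrow>
             (\<exists>g. convex_block_subsequence g f \<and> g \<longlonglongrightarrow> 0))))"
proof (intro conjI allI impI iffI)
  fix f :: "nat \<Rightarrow> 'a \<Rightarrow>\<^sub>L real"
  assume "grothendieck_property ((*\<^sub>R) :: real \<Rightarrow> 'a \<Rightarrow> 'a)" "weak_star_converges (*\<^sub>R) f 0"
  \<comment> \<open>Over the reals, \<open>h\<close> itself is the bidual element dominating
    \<open>h\<close>.\<close>
  then show "\<exists>g. convex_block_subsequence g f \<and> g \<longlonglongrightarrow> 0"
    by (rule grothendieck_imp_null_blocks)
      (auto intro!: bexI[OF _ real_functional_in_bidual])
next
  assume blocks: "\<forall>f. weak_star_converges ((*\<^sub>R) :: real \<Rightarrow> 'a \<Rightarrow> 'a) f 0 \<longrightarrow>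
    (\<exists>g. convex_block_subsequence g f \<and> g \<longlonglongrightarrow> 0)"
  show "grothendieck_property ((*\<^sub>R) :: real \<Rightarrow> 'a \<Rightarrow> 'a)"
    by (rule grothendieck_if_null_blocks) (rule blocks[rule_format])
next
  fix smul :: "complex \<Rightarrow> 'a \<Rightarrow> 'a" and f
  assume "grothendieck_property smul" "weak_star_converges smul f 0"
  then show "\<exists>g. convex_block_subsequence g f \<and> g \<longlonglongrightarrow> 0"
    by (rule grothendieck_imp_null_blocks) (rule complex_bidual_dominates_real_functional)
next
  fix smul :: "complex \<Rightarrow> 'a \<Rightarrow> 'a"
  assume blocks: "\<forall>f. weak_star_converges smul f 0 \<longrightarrow>
    (\<exists>g. convex_block_subsequence g f \<and> g \<longlonglongrightarrow> 0)"
  show "grothendieck_property smul"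
    by (rule grothendieck_if_null_blocks) (rule blocks[rule_format])
qed

end
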